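(* Let $G=(V,E)$ be a graph and let $k\ge 1$ be an integer. Then $G$ is a $k$-median graph if and only if there are $k$ (distinct) vertices $\mu_1,\dots,\mu_k\in V$ such that, for each $1\le i\le k$, the vertex $\mu_i$ is a median-consistent vertex in every $\mu_i$-convex subgraph of $G$.
   Context: All graphs are finite, simple and undirected; $d_G$ is the shortest-path distance. For $x,y\in V(G)$, the interval $I_G(x,y)$ is the set of all vertices lying on shortest $(x,y)$-paths in $G$ (it is empty if $x,y$ lie in different connected components), and $I_G(x,y,z):=I_G(x,y)\cap I_G(x,z)\cap I_G(y,z)$. A vertex $\mu\in V(G)$ is median-consistent in $G$ if $|I_G(\mu,x,y)|=1$ for all $x,y\in V(G)$. A graph is a $k$-median graph ($k\geq 1$) if it has (at least) $k$ median-consistent vertices. Subgraphs need not be induced. For $v\in V(G)$, a subgraph $H$ of $G$ is $v$-convex if $v\in V(H)$ and, for all $x\in V(H)$, every shortest path in $G$ connecting $v$ and $x$ is contained in $H$ (all its vertices and edges). *)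

theory Defs
  imports "Graph_Theory.Graph_Theory"
begin

text \<open>
  A finite simple undirected graph is a \<^locale>\<open>graph\<close>: a finite symmetric digraph without loops
  or parallel arcs, so that an edge is a pair of opposite arcs. Accordingly a subgraph of such a
  graph is a \<^const>\<open>subgraph\<close> that is itself a \<^locale>\<open>graph\<close>; it need not be induced.
\<close>

definition shortest_path :: "('a, 'b) pre_digraph \<Rightarrow> 'a \<Rightarrow> 'b awalk \<Rightarrow> 'a \<Rightarrow> bool" where
  "shortest_path G x p y \<longleftrightarrow>
     pre_digraph.apath G x p y \<and> (\<forall>q. pre_digraph.apath G x q y \<longrightarrow> length p \<le> length q)"

definition interval :: "('a, 'b) pre_digraph \<Rightarrow> 'a \<Rightarrow> 'a \<Rightarrow> 'a set" where
  "interval G x y =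
     {z. \<exists>p. shortest_path G x p y \<and> z \<in> set (pre_digraph.awalk_verts G x p)}"

definition interval3 :: "('a, 'b) pre_digraph \<Rightarrow> 'a \<Rightarrow> 'a \<Rightarrow> 'a \<Rightarrow> 'a set" where
  "interval3 G x y z = interval G x y \<inter> interval G x z \<inter> interval G y z"

definition median_consistent :: "('a, 'b) pre_digraph \<Rightarrow> 'a \<Rightarrow> bool" where
  "median_consistent G v \<longleftrightarrow>
     v \<in> verts G \<and> (\<forall>x \<in> verts G. \<forall>y \<in> verts G. card (interval3 G v x y) = 1)"

definition k_median_graph :: "nat \<Rightarrow> ('a, 'b) pre_digraph \<Rightarrow> bool" where
  "k_median_graph k G \<longleftrightarrow> graph G \<and> k \<le> card {v \<in> verts G. median_consistent G v}"

definition convex_subgraph :: "('a, 'b) pre_digraph \<Rightarrow> 'a \<Rightarrow> ('a, 'b) pre_digraph \<Rightarrow> bool" where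
  "convex_subgraph G v H \<longleftrightarrow>
     graph H \<and> subgraph H G \<and> v \<in> verts H \<and>
     (\<forall>x \<in> verts H. \<forall>p. shortest_path G v p x \<longrightarrow>
        set (pre_digraph.awalk_verts G v p) \<subseteq> verts H \<and> set p \<subseteq> arcs H)"

end

(* A v-convex subgraph H contains the median m of v, x, y in G, since m lies on a shortest path from
   v to x. The shortest paths from v to x and to y through m lie in H, and so do their parts from m
   to x and from m to y; glued together, these form a shortest path of G from x to y. So H preserves
   all distances, and its intervals are contained in those of G. Hence m is in all three intervals
   of H, and any other vertex in them would be a second median in G. *)

theory Submission
  imports Defs
begin

text \<open>A walk that repeats a vertex contains a nonempty closed piece. Cutting that piece out
  leaves a strictly shorter walk with the same ends, so induction on the length applies.\<close>

lemma (in wf_digraph) awalk_imp_apath_le: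
  assumes "awalk x p y"
  obtains q where "apath x q y" "length q \<le> length p"
  using assms
proof (induction "length p" arbitrary: p thesis rule: less_induct)
  case less
  show ?case
  proof (cases "distinct (awalk_verts x p)")
    case True
    then show ?thesis using less.prems by (auto simp: apath_def)
  next
    case False
    from awalk_not_distinct_decomp[OF less.prems(2) False]
    obtain q r s w where "p = q @ r @ s" "0 < length r" "awalk x q w" "awalk w s y"
      by blast
    then have shorter: "length (q @ s) < length p" "awalk x (q @ s) y"
      by auto
    show ?thesis
    proof (rule less.hyps[OF shorter(1) _ shorter(2)])
      fix r assume "apath x r y" "length r \<le> length (q @ s)"
      then show ?thesis
        using less.prems(1) shorter(1) by simp
    qed
  qed
qed

text \<open>Minimality among walks is easier to handle than minimality among paths: walks can be
  glued and split with no check that vertices stay distinct. A shortest walk is a path because a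
  closed piece could be cut out of it.\<close>

lemma (in wf_digraph) shortest_path_iff_awalk:
  "shortest_path G x p y \<longleftrightarrow> awalk x p y \<and> (\<forall>q. awalk x q y \<longrightarrow> length p \<le> length q)"
proof
  assume "shortest_path G x p y"
  then show "awalk x p y \<and> (\<forall>q. awalk x q y \<longrightarrow> length p \<le> length q)"
    unfolding shortest_path_def
    by (meson awalkI_apath awalk_imp_apath_le order_trans)
next
  assume p: "awalk x p y \<and> (\<forall>q. awalk x q y \<longrightarrow> length p \<le> length q)"
  have "distinct (awalk_verts x p)"
  proof (rule ccontr)
    assume "\<not> distinct (awalk_verts x p)"
    from awalk_not_distinct_decomp[OF conjunct1[OF p] this]
    obtain q r s w where "p = q @ r @ s" "0 < length r" "awalk x q w" "awalk w s y"
      by blast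
    then have "awalk x (q @ s) y" "length (q @ s) < length p"
      by auto
    with p show False
      by (meson not_le)
  qed
  with p show "shortest_path G x p y"
    by (auto simp: shortest_path_def apath_def)
qed

text \<open>Exposes the two halves of a shortest path on either side of \<open>z\<close>, so that
  they can be recombined with halves of other paths.\<close>

lemma (in wf_digraph) mem_interval_iff:
  "z \<in> interval G x y \<longleftrightarrow>
    (\<exists>p q. awalk x p z \<and> awalk z q y \<and> shortest_path G x (p @ q) y)"
proof
  assume "z \<in> interval G x y"
  then obtain r where r: "shortest_path G x r y" "z \<in> set (awalk_verts x r)"
    by (auto simp: interval_def)
  then have "awalk x r y"
    by (simp add: shortest_path_iff_awalk)
  from awalk_decomp[OF this r(2)] r(1)
  show "\<exists>p q. awalk x p z \<and> awalk z q y \<and> shortest_path G x (p @ q) y"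
    by blast
next
  assume "\<exists>p q. awalk x p z \<and> awalk z q y \<and> shortest_path G x (p @ q) y"
  then obtain p q where pq: "awalk x p z" "awalk z q y" "shortest_path G x (p @ q) y"
    by blast
  then have "awalk x (p @ q) y"
    by auto
  then have "z \<in> set (awalk_verts x (p @ q))"
    using set_awalk_verts_append[OF pq(1,2)] hd_in_awalk_verts(1)[OF pq(2)] by simp
  with pq(3) show "z \<in> interval G x y"
    by (auto simp: interval_def)
qed

lemma (in sym_digraph) awalk_reverse:
  assumes "awalk x p y"
  obtains q where "awalk y q x" "length q = length p"
  using assms
proof (induction p arbitrary: x thesis)
  case Nil
  then show ?case
    by (metis awalk_Nil_iff)
next
  case (Cons e p)
  then have e: "e \<in> arcs G" "tail G e = x" and p: "awalk (head G e) p y"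
    by (auto simp: awalk_Cons_iff)
  from Cons.IH[OF _ p] obtain q where q: "awalk y q (head G e)" "length q = length p"
    by blast
  \<comment> \<open>An undirected edge is a pair of opposite arcs; \<open>f\<close> is the partner
    of \<open>e\<close>. The reversed walk uses other arcs than \<open>p\<close>, so only its length
    is recorded.\<close>
  have "(head G e, x) \<in> arcs_ends G"
    using e graph_symmetric in_arcs_imp_in_arcs_ends by blast
  then obtain f where "f \<in> arcs G" "tail G f = head G e" "head G f = x"
    by (auto simp: arcs_ends_def arc_to_ends_def)
  then have "awalk (head G e) [f] x"
    using arc_implies_awalk by metis
  with q have "awalk y (q @ [f]) x" "length (q @ [f]) = length (e # p)"
    by auto
  then show ?case
    by (rule Cons.prems(1))
qed

text \<open>Otherwise, replacing \<open>q\<close> by \<open>r\<close> after \<open>p\<close> would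
  give a shorter walk from \<open>x\<close> to \<open>y\<close>.\<close>

lemma (in wf_digraph) shortest_path_suffix:
  assumes "shortest_path G x (p @ q) y" "awalk x p z" "awalk z r y"
  shows "length q \<le> length r"
proof -
  have "awalk x (p @ r) y"
    using assms by auto
  with assms(1) have "length (p @ q) \<le> length (p @ r)"
    unfolding shortest_path_iff_awalk by blast
  then show ?thesis
    by simp
qed

text \<open>Every walk of \<open>H\<close> is a walk of \<open>G\<close>, so there are fewer
  competitors in \<open>H\<close>.\<close>

lemma (in wf_digraph) shortest_path_subgraph:
  assumes "subgraph H G" "pre_digraph.awalk H x p y" "shortest_path G x p y"
  shows "shortest_path H x p y"
proof -
  interpret H: wf_digraph H
    using assms(1) by auto
  show ?thesis
    using assms subgraph_awalk_imp_awalk[OF _ assms(1)]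
    by (auto simp: shortest_path_iff_awalk H.shortest_path_iff_awalk)
qed

text \<open>The walk \<open>p\<close> shows that \<open>x\<close> and \<open>y\<close> have the same
  distance in \<open>H\<close> as in \<open>G\<close>. Hence a shortest path of \<open>H\<close>
  between them is also shortest in \<open>G\<close>.\<close>

lemma (in wf_digraph) interval_subgraph_subset:
  assumes "subgraph H G" "pre_digraph.awalk H x p y" "shortest_path G x p y"
  shows "interval H x y \<subseteq> interval G x y"
proof
  interpret H: wf_digraph H
    using assms(1) by auto
  fix z assume "z \<in> interval H x y"
  then obtain q r where qr: "H.awalk x q z" "H.awalk z r y" "shortest_path H x (q @ r) y"
    by (auto simp: H.mem_interval_iff)
  then have "length (q @ r) \<le> length p"
    using assms(2) H.shortest_path_iff_awalk by blast
  moreover have "awalk x q z" "awalk z r y"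
    using qr subgraph_awalk_imp_awalk[OF _ assms(1)] by auto
  ultimately have "shortest_path G x (q @ r) y"
    using assms(3) unfolding shortest_path_iff_awalk
    by (meson awalk_appendI order_trans)
  with \<open>awalk x q z\<close> \<open>awalk z r y\<close> show "z \<in> interval G x y"
    by (auto simp: mem_interval_iff)
qed

text \<open>Convexity puts the arcs of \<open>p\<close>, and not just its vertices, into
  \<open>H\<close>, and a subgraph inherits the heads and tails of its arcs.\<close>

lemma convex_subgraph_shortest_path:
  assumes "convex_subgraph G v H" "x \<in> verts H" "shortest_path G v p x"
  shows "pre_digraph.awalk H v p x"
proof -
  have sub: "subgraph H G" and v: "v \<in> verts H" and p: "set p \<subseteq> arcs H"
    using assms by (auto simp: convex_subgraph_def)
  have "pre_digraph.cas G v p x"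
    using assms(3) by (simp add: shortest_path_def pre_digraph.apath_def pre_digraph.awalk_def)
  moreover have "pre_digraph.cas G = pre_digraph.cas H"
    using sub by (intro compatible_cas) auto
  ultimately show ?thesis
    using v p by (simp add: pre_digraph.awalk_def)
qed

lemma median_consistent_convex_subgraph:
  assumes "graph G" "median_consistent G v" "convex_subgraph G v H"
  shows "median_consistent H v"
proof -
  interpret G: graph G by fact
  interpret H: graph H
    using assms(3) by (simp add: convex_subgraph_def)
  have sub: "subgraph H G" and vH: "v \<in> verts H"
    using assms(3) by (auto simp: convex_subgraph_def)
  have "card (interval3 H v x y) = 1" if x: "x \<in> verts H" and y: "y \<in> verts H" for x y
  proof -
    have "x \<in> verts G" "y \<in> verts G"
      using x y sub by auto
    then have "card (interval3 G v x y) = 1"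
      using assms(2) by (simp add: median_consistent_def)
    then obtain m where m: "interval3 G v x y = {m}"
      by (auto simp: card_1_singleton_iff)
    then have "m \<in> interval G v x" "m \<in> interval G v y" "m \<in> interval G x y"
      by (auto simp: interval3_def)
    then obtain p1 p2 q1 q2 r1 r2 where
      p: "G.awalk v p1 m" "G.awalk m p2 x" "shortest_path G v (p1 @ p2) x" and
      q: "G.awalk v q1 m" "G.awalk m q2 y" "shortest_path G v (q1 @ q2) y" and
      r: "G.awalk x r1 m" "G.awalk m r2 y" "shortest_path G x (r1 @ r2) y"
      by (auto simp: G.mem_interval_iff)
    have pH: "H.awalk v (p1 @ p2) x" and qH: "H.awalk v (q1 @ q2) y"
      using convex_subgraph_shortest_path[OF assms(3)] x y p(3) q(3) by blast+
    \<comment> \<open>Splitting in \<open>H\<close> gives some intermediate vertex \<open>w\<close>.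
      It is \<open>m\<close>, since the start and the arcs of a walk in \<open>G\<close> determine
      its end.\<close>
    have split: "H.awalk v s1 m \<and> H.awalk m s2 z"
      if "G.awalk v s1 m" "H.awalk v (s1 @ s2) z" for s1 s2 z
    proof -
      obtain w where w: "H.awalk v s1 w" "H.awalk w s2 z"
        using \<open>H.awalk v (s1 @ s2) z\<close> by auto
      then have "G.awalk v s1 w"
        using G.subgraph_awalk_imp_awalk sub by blast
      then have "w = m"
        using \<open>G.awalk v s1 m\<close> G.awalk_ends by blast
      with w show ?thesis
        by simp
    qed
    have pH12: "H.awalk v p1 m" "H.awalk m p2 x" and qH12: "H.awalk v q1 m" "H.awalk m q2 y"
      using split p(1) q(1) pH qH by blast+
    obtain s where s: "H.awalk x s m" "length s = length p2"
      using H.awalk_reverse pH12(2) by blast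
    \<comment> \<open>\<open>p2\<close> runs from \<open>m\<close> to \<open>x\<close> but
      \<open>r1\<close> from \<open>x\<close> to \<open>m\<close>; reversing \<open>r1\<close> makes
      their lengths comparable.\<close>
    obtain r1' where r1': "G.awalk m r1' x" "length r1' = length r1"
      using G.awalk_reverse r(1) by blast
    have "length s \<le> length r1"
      using G.shortest_path_suffix[OF p(3) p(1) r1'(1)] s(2) r1'(2) by simp
    moreover have "length q2 \<le> length r2"
      using G.shortest_path_suffix[OF q(3) q(1) r(2)] .
    ultimately have len: "length (s @ q2) \<le> length (r1 @ r2)"
      by simp
    have sH: "H.awalk x (s @ q2) y"
      using s(1) qH12(2) by auto
    then have "G.awalk x (s @ q2) y"
      using G.subgraph_awalk_imp_awalk sub by blast
    with len r(3) have sG: "shortest_path G x (s @ q2) y"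
      unfolding G.shortest_path_iff_awalk by (meson order_trans)
    \<comment> \<open>The three shortest paths of \<open>G\<close> that lie in \<open>H\<close> and
      pass through \<open>m\<close> are \<open>p1 @ p2\<close>, \<open>q1 @ q2\<close> and
      \<open>s @ q2\<close>.\<close>
    have "m \<in> interval3 H v x y"
      unfolding interval3_def H.mem_interval_iff Int_iff
      using G.shortest_path_subgraph[OF sub pH p(3)] G.shortest_path_subgraph[OF sub qH q(3)]
        G.shortest_path_subgraph[OF sub sH sG] pH12 qH12 s(1) by blast
    moreover have "interval3 H v x y \<subseteq> interval3 G v x y"
      using G.interval_subgraph_subset[OF sub pH p(3)] G.interval_subgraph_subset[OF sub qH q(3)]
        G.interval_subgraph_subset[OF sub sH sG] unfolding interval3_def by blast
    ultimately have "interval3 H v x y = {m}"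
      using m by blast
    then show ?thesis
      by simp
  qed
  then show ?thesis
    using vH by (simp add: median_consistent_def)
qed

text \<open>Lets the converse direction of the theorem specialise the convex subgraph to
  \<open>G\<close> itself.\<close>

lemma convex_subgraph_refl:
  assumes "graph G" "v \<in> verts G"
  shows "convex_subgraph G v G"
proof -
  interpret graph G by fact
  have "set (awalk_verts v p) \<subseteq> verts G \<and> set p \<subseteq> arcs G"
    if "shortest_path G v p x" for p x
  proof -
    have "awalk v p x"
      using that by (simp add: shortest_path_def awalkI_apath)
    then show ?thesis
      by (elim awalkE') (intro conjI)
  qed
  then show ?thesis
    using assms subgraph_refl by (simp add: convex_subgraph_def)
qed

theorem mainTheorem1:
  fixes G :: "('a, 'b) pre_digraph" and k :: nat
  assumes "graph G" and "k \<ge> 1"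
  shows "k_median_graph k G \<longleftrightarrow>
    (\<exists>\<mu> :: nat \<Rightarrow> 'a. inj_on \<mu> {1..k} \<and>
       (\<forall>i \<in> {1..k}. \<mu> i \<in> verts G \<and>
          (\<forall>H. convex_subgraph G (\<mu> i) H \<longrightarrow> median_consistent H (\<mu> i))))"
  (is "?L \<longleftrightarrow> ?R")
proof
  let ?M = "{v \<in> verts G. median_consistent G v}"
  assume ?L
  then have "k \<le> card ?M"
    by (simp add: k_median_graph_def)
  \<comment> \<open>There may be more than \<open>k\<close> median-consistent vertices; exactly
    \<open>k\<close> of them are selected and numbered from 1 to \<open>k\<close>.\<close>
  then obtain T where T: "T \<subseteq> ?M" "card T = k" "finite T"
    by (rule obtain_subset_with_card_n)
  from ex_bij_betw_nat_finite_1[OF T(3)] T(2)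
  obtain \<mu> where \<mu>: "bij_betw \<mu> {1..k} T"
    by blast
  then have "\<mu> i \<in> ?M" if "i \<in> {1..k}" for i
    using T(1) that bij_betwE by blast
  then show ?R
    using \<mu> median_consistent_convex_subgraph[OF assms(1)]
    by (intro exI[of _ \<mu>]) (auto simp: bij_betw_def)
next
  let ?M = "{v \<in> verts G. median_consistent G v}"
  interpret graph G by fact
  assume ?R
  then obtain \<mu> :: "nat \<Rightarrow> 'a" where inj: "inj_on \<mu> {1..k}"
    and \<mu>: "\<forall>i \<in> {1..k}. \<mu> i \<in> verts G \<and>
      (\<forall>H. convex_subgraph G (\<mu> i) H \<longrightarrow> median_consistent H (\<mu> i))"
    by blast
  \<comment> \<open>Instantiates \<open>H\<close> with \<open>G\<close>. Injectivity of
    \<open>\<mu>\<close> then makes this image a set of \<open>k\<close> elements.\<close>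
  then have "\<mu> ` {1..k} \<subseteq> ?M"
    using convex_subgraph_refl[OF assms(1)] by blast
  then have "card (\<mu> ` {1..k}) \<le> card ?M"
    by (intro card_mono) auto
  then show ?L
    using inj assms(1) by (simp add: k_median_graph_def card_image)
qed

end
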